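(* Let $G$ be a graph with $n\geq 1$ vertices and let $K_{m_1,m_2,\ldots,m_k}$ be a complete multipartite graph (disjoint from $G$) such that the join $K_{m_1,\ldots,m_k}+G$ is not complete. Let $m_{i_1},m_{i_2},\ldots,m_{i_q}$ be the distinct values among $m_1,\ldots,m_k$, where $m_{i_p}$ appears exactly $a_p$ times for each $p\in[q]$. Let $$P(\lambda):=1+\sum_{p=1}^q\frac{a_pm_{i_p}}{\lambda+m_{i_p}},\qquad \lambda\in\mathbb{R}\setminus\{-m_{i_1},\ldots,-m_{i_q}\},$$ and let $\lambda_1,\lambda_2,\ldots,\lambda_q$ be the zeros of $P$. Then $$\mathrm{QEC}(K_{m_1,\ldots,m_k}+G)=-2-\min\left(\bigcup_{i=1}^4\big(\Lambda_i\cap(-\infty,-1)\big)\cup\{-m_{i_p}:\ p\in[q],\ a_p\geq 2,\ m_{i_p}\neq 1\}\right),$$ where \begin{align*} \Lambda_1&:=\{-m_{i_p}:\ p\in[q],\ a_p=1\}\cap\sigma(A_G-J),\\ \Lambda_2&:=\{\lambda_p:\ p\in[q]\}\cap\sigma(A_G),\\ \Lambda_3&:=\sigma_0(A_G)\setminus\{-m_{i_p},\lambda_p:\ p\in[q]\},\\ \Lambda_4&:=\big\{\lambda\in\mathbb{R}\setminus\big(\{-m_{i_p},\lambda_p:\ p\in[q]\}\cup\sigma(A_G)\big):\ P(\lambda)\langle e,(A_G-\lambda I)^{-1}e\rangle=P(\lambda)-1\big\}. \end{align*}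
   Context: All graphs are finite, simple and unweighted (undirected). For a graph $G$, $A_G$ is its adjacency matrix. For a connected graph $G=(V,E)$, $D_G$ is its distance matrix (entries are shortest-path distances), and the quadratic embedding constant is $\mathrm{QEC}(G):=\max\{\langle f,D_Gf\rangle : f\in\mathbb{R}^{V},\ \langle f,f\rangle=1,\ \langle e,f\rangle=0\}$. Here $e$ is the all-ones vector, $J$ the all-ones matrix and $I$ the identity matrix of the appropriate size, and $\langle\cdot,\cdot\rangle$ is the standard inner product; $[q]=\{1,\ldots,q\}$. For a square matrix $M$, $\sigma(M)$ is the set of eigenvalues of $M$, and $\sigma_0(M)$ is the set of $\lambda\in\sigma(M)$ having an associated eigenvector $x$ with $\langle e,x\rangle=0$. The complete multipartite graph $K_{m_1,\ldots,m_k}$ has vertex set partitioned into parts of sizes $m_1,\ldots,m_k\ge 1$, two vertices being adjacent iff they lie in different parts. The join $G_1+G_2$ of two disjoint graphs $G_1=(V_1,E_1)$, $G_2=(V_2,E_2)$ has vertex set $V_1\cup V_2$ and edge set $E_1\cup E_2$ together with all edges joining a vertex of $V_1$ to a vertex of $V_2$. The function $P$ has exactly $q$ zeros, all of them negative real numbers. *)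

theory Defs
  imports "HOL-Analysis.Analysis" "Graph_Theory.Graph_Theory"
begin

text \<open>
  A finite simple undirected graph is a \<^locale>\<open>pair_graph\<close> of Graph\_Theory: each edge is stored as
  two opposite arcs, and there are no loops. Matrices and vectors are indexed by the (finite) type
  of vertices, so the notions below are meant for graphs whose vertex set is \<^term>\<open>UNIV\<close>.
\<close>

definition adj_matrix :: "'v::finite pair_pre_digraph \<Rightarrow> real^'v^'v" where
  "adj_matrix G = (\<chi> u v. if (u, v) \<in> parcs G then 1 else 0)"

text \<open>
  With unit arc weights the library's \<open>\<mu>\<close> is the shortest-path distance, as an extended real; it is
  infinite only between different components, so the conversion to \<^typ>\<open>real\<close> is harmless for
  connected graphs.
\<close>

definition dist_matrix :: "'v::finite pair_pre_digraph \<Rightarrow> real^'v^'v" where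
  "dist_matrix G = (\<chi> u v. real_of_ereal (wf_digraph.\<mu> (with_proj G) (\<lambda>_. 1) u v))"

definition all_ones :: "real^'n::finite" where
  "all_ones = (\<chi> i. 1)"

definition ones_matrix :: "real^'n^'n::finite" where
  "ones_matrix = (\<chi> i j. 1)"

definition QEC :: "'v::finite pair_pre_digraph \<Rightarrow> real" where
  "QEC G = (GREATEST r. r \<in> {f \<bullet> (dist_matrix G *v f) | f. f \<bullet> f = 1 \<and> all_ones \<bullet> f = 0})"

text \<open>Real eigenvalues; these are all the eigenvalues for the symmetric matrices considered here.\<close>

definition eigenvalues :: "real^'n^'n::finite \<Rightarrow> real set" where
  "eigenvalues M = {r. \<exists>x. x \<noteq> 0 \<and> M *v x = r *\<^sub>R x}"

definition eigenvalues0 :: "real^'n^'n::finite \<Rightarrow> real set" where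
  "eigenvalues0 M = {r. \<exists>x. x \<noteq> 0 \<and> M *v x = r *\<^sub>R x \<and> all_ones \<bullet> x = 0}"

text \<open>\<open>complete_multipartite K k m\<close>: the graph \<open>K\<close> is a copy of $K_{m_1,\ldots,m_k}$.\<close>

definition complete_multipartite :: "'w pair_pre_digraph \<Rightarrow> nat \<Rightarrow> (nat \<Rightarrow> nat) \<Rightarrow> bool" where
  "complete_multipartite K k m \<longleftrightarrow> (\<exists>V.
     pverts K = (\<Union>j\<in>{1..k}. V j) \<and> disjoint_family_on V {1..k} \<and>
     (\<forall>j\<in>{1..k}. finite (V j) \<and> card (V j) = m j \<and> m j \<ge> 1) \<and>
     parcs K = {(u, v). \<exists>j\<in>{1..k}. \<exists>l\<in>{1..k}. j \<noteq> l \<and> u \<in> V j \<and> v \<in> V l})"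

text \<open>The two vertex sets are made disjoint by the sum type.\<close>

definition graph_join ::
  "'a pair_pre_digraph \<Rightarrow> 'b pair_pre_digraph \<Rightarrow> ('a + 'b) pair_pre_digraph" where
  "graph_join G1 G2 =
     \<lparr> pverts = Inl ` pverts G1 \<union> Inr ` pverts G2,
       parcs = {(Inl u, Inl v) | u v. (u, v) \<in> parcs G1} \<union> {(Inr u, Inr v) | u v. (u, v) \<in> parcs G2}
         \<union> {(Inl u, Inr v) | u v. u \<in> pverts G1 \<and> v \<in> pverts G2}
         \<union> {(Inr v, Inl u) | u v. u \<in> pverts G1 \<and> v \<in> pverts G2} \<rparr>"

end

theory Submission
  imports Defs
begin

text \<open>
  Write \<open>e\<close> for the all-ones vector and \<open>B\<close> for the adjacency matrix of the join. Two nonadjacent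
  vertices of a join have a common neighbour, so the distance matrix is \<open>2 J - 2 I - B\<close>
  (\<open>dist_matrix_diameter_two\<close>). On unit vectors orthogonal to \<open>e\<close> the distance form therefore
  equals \<open>- 2 - \<langle>f, B f\<rangle>\<close>, and the constant is \<open>- 2 - \<mu>\<close>, where \<open>\<mu>\<close> is the minimum of the
  adjacency form over those vectors. By Lagrange multipliers (\<open>least_compressed_eigenvalue\<close>), \<open>\<mu>\<close>
  is the least number \<open>r\<close> for which \<open>B f = r f + c e\<close> has a solution with \<open>f \<noteq> 0\<close> and
  \<open>\<langle>e, f\<rangle> = 0\<close>.

  The rest is the determination of these numbers \<open>r\<close>. For \<open>r \<noteq> 0\<close> such an \<open>f\<close> is constant on each
  part of the multipartite factor (\<open>compressed_eigenvalue_join_iff\<close>). With \<open>\<xi> j\<close> its value on part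
  \<open>j\<close>, \<open>y\<close> its restriction to \<open>G\<close> and \<open>s = (\<Sum>j. m j * \<xi> j)\<close>, the equations become
  \<open>(r + m j) \<xi> j = - c\<close>, \<open>A y = r y + (c - s) e\<close> and \<open>\<langle>e, y\<rangle> = - s\<close>. The four sets of the theorem
  and its additional set of numbers \<open>- m j\<close> are the cases of solving them:
  \<^item> If \<open>r = - m j\<close>, then \<open>c = 0\<close>. A repeated size always gives a solution; a size that occurs once
    leads to the matrix \<open>A - J\<close>.
  \<^item> Otherwise \<open>\<xi>\<close> is determined by \<open>c\<close>, and \<open>A y = r y + c P(r) e\<close>, \<open>\<langle>e, y\<rangle> = c (P(r) - 1)\<close>
    remain. If \<open>P(r) = 0\<close>, any eigenvector \<open>y\<close> of \<open>A\<close> works, with \<open>c = - \<langle>e, y\<rangle>\<close>. If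
    \<open>P(r) \<noteq> 0\<close>, either \<open>c = 0\<close> and \<open>y\<close> is an eigenvector orthogonal to \<open>e\<close>, or the resolvent of
    \<open>A\<close> turns the last condition into the scalar equation of the fourth set.

  Only the numbers below \<open>- 1\<close> matter: a join that is not complete contains an induced path on three
  vertices, which gives \<open>\<mu> \<le> - 4 / 3\<close> (\<open>induced_path_test_vector\<close>).
\<close>

section \<open>Distance matrices of graphs of diameter at most two\<close>

lemma adj_matrix_symmetric:
  assumes "pair_graph H"
  shows "transpose (adj_matrix H) = adj_matrix H"
proof -
  interpret pair_graph H by fact
  have "(v, u) \<in> parcs H \<longleftrightarrow> (u, v) \<in> parcs H" for u v
    using pair_sym_arcs by (auto simp: symmetric_def sym_def)
  then show ?thesis by (simp add: adj_matrix_def transpose_def vec_eq_iff)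
qed

lemma shortest_path_eqI:
  assumes "wf_digraph H" "pre_digraph.awalk H u p v"
    and "\<And>p'. pre_digraph.awalk H u p' v \<Longrightarrow> length p \<le> length p'"
  shows "wf_digraph.\<mu> H (\<lambda>_. 1) u v = ereal (real (length p))"
proof -
  interpret wf_digraph H by fact
  have cost: "awalk_cost (\<lambda>_. 1) p' = real (length p')" for p' :: "'b list"
    by (induct p') auto
  show ?thesis unfolding \<mu>_def cost
    using assms(2,3) by (intro INF_eqI) (auto intro: INF_lower)
qed

lemma dist_matrix_diameter_two:
  fixes H :: "'v::finite pair_pre_digraph"
  assumes "pair_graph H" and verts: "pverts H = UNIV"
    and two: "\<And>u v. u \<noteq> v \<Longrightarrow> (u, v) \<notin> parcs H \<Longrightarrow> \<exists>w. (u, w) \<in> parcs H \<and> (w, v) \<in> parcs H"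
  shows "dist_matrix H = 2 *\<^sub>R ones_matrix - 2 *\<^sub>R mat 1 - adj_matrix H"
proof -
  interpret pair_graph H by fact
  note wf = wf_digraph_axioms
  have "real_of_ereal (wf_digraph.\<mu> (with_proj H) (\<lambda>_. 1) u v)
      = 2 - 2 * (if u = v then 1 else 0) - (if (u, v) \<in> parcs H then 1 else 0)" for u v
  proof -
    consider "u = v" | "u \<noteq> v" "(u, v) \<in> parcs H" | "u \<noteq> v" "(u, v) \<notin> parcs H" by blast
    then show ?thesis
    proof cases
      case 1
      have "(u, v) \<notin> parcs H" using pair_no_loops 1 by fastforce
      moreover have "awalk u [] v" by (simp add: awalk_def verts 1)
      from shortest_path_eqI[OF wf this] have "\<mu> (\<lambda>_. 1) u v = 0" by (simp add: zero_ereal_def)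
      ultimately show ?thesis by (simp add: 1)
    next
      case 2
      have "awalk u [(u, v)] v" by (simp add: awalk_def verts 2)
      moreover have "length [(u, v)] \<le> length p" if "awalk u p v" for p
        using that 2(1) by (cases p) (auto simp: awalk_def)
      ultimately have "\<mu> (\<lambda>_. 1) u v = 1"
        using shortest_path_eqI[OF wf] by (fastforce simp: one_ereal_def)
      then show ?thesis by (simp add: 2)
    next
      case 3
      then obtain w where w: "(u, w) \<in> parcs H" "(w, v) \<in> parcs H" using two by blast
      have "awalk u [(u, w), (w, v)] v" by (simp add: awalk_def verts w)
      moreover have "length [(u, w), (w, v)] \<le> length p" if "awalk u p v" for p
      proof (rule ccontr)
        assume "\<not> ?thesis"
        then have "length p = 0 \<or> length p = 1" by (auto simp: not_le less_Suc_eq)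
        then show False using that 3 by (auto simp: awalk_def length_Suc_conv)
      qed
      ultimately have "\<mu> (\<lambda>_. 1) u v = ereal (real 2)"
        using shortest_path_eqI[OF wf, of u "[(u, w), (w, v)]" v] by (simp add: numeral_2_eq_2)
      then show ?thesis by (simp add: 3)
    qed
  qed
  then show ?thesis
    by (auto simp: dist_matrix_def adj_matrix_def ones_matrix_def mat_def vec_eq_iff)
qed

section \<open>Minimizing a quadratic form on the hyperplane of zero-sum vectors\<close>

lemma ones_matrix_mult: "ones_matrix *v f = (all_ones \<bullet> f) *\<^sub>R all_ones"
  by (simp add: vec_eq_iff ones_matrix_def all_ones_def matrix_vector_mult_def inner_vec_def)

lemma inner_all_ones: "all_ones \<bullet> f = (\<Sum>i\<in>UNIV. f $ i)"
  by (simp add: all_ones_def inner_vec_def)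

lemma all_ones_nonzero: "all_ones \<noteq> (0 :: real^'n::finite)"
  by (simp add: all_ones_def vec_eq_iff)

lemma symmetric_inner_commute:
  fixes M :: "real^'n::finite^'n"
  assumes "transpose M = M"
  shows "(M *v f) \<bullet> g = f \<bullet> (M *v g)"
  by (metis assms dot_lmul_matrix transpose_matrix_vector)

text \<open>
  These are the eigenvalues of the compression of \<open>M\<close> to the hyperplane orthogonal to
  \<^const>\<open>all_ones\<close>; \<open>c\<close> is the Lagrange multiplier of the constraint.
\<close>

definition compressed_eigenvalues :: "real^'n^'n::finite \<Rightarrow> real set" where
  "compressed_eigenvalues M =
     {r. \<exists>f c. f \<noteq> 0 \<and> all_ones \<bullet> f = 0 \<and> M *v f = r *\<^sub>R f + c *\<^sub>R all_ones}"

text \<open>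
  The quadratic form attains its minimum \<open>\<mu>\<close> over the unit sphere of the hyperplane by compactness.
  The form \<open>g \<bullet> M g - \<mu> (g \<bullet> g)\<close> is then nonnegative on the hyperplane and vanishes at the
  minimizer \<open>f\<close>, so its first variation \<open>g \<bullet> (M f - \<mu> f)\<close> vanishes for every \<open>g\<close> in the
  hyperplane, which makes \<open>M f - \<mu> f\<close> a multiple of \<^const>\<open>all_ones\<close>.
\<close>

lemma least_compressed_eigenvalue:
  fixes M :: "real^'n::finite^'n" and f0 :: "real^'n"
  assumes sym: "transpose M = M" and ex: "f0 \<noteq> 0" "all_ones \<bullet> f0 = 0"
  obtains \<mu> where "\<mu> \<in> compressed_eigenvalues M"
    and "\<And>f. all_ones \<bullet> f = 0 \<Longrightarrow> \<mu> * (f \<bullet> f) \<le> f \<bullet> (M *v f)"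
proof -
  define B where "B = {f :: real^'n. norm f = 1 \<and> all_ones \<bullet> f = 0}"
  have "B = sphere 0 1 \<inter> {f. all_ones \<bullet> f = 0}" by (auto simp: B_def)
  then have "compact B" by (simp add: compact_Int_closed closed_hyperplane)
  moreover have "(1 / norm f0) *\<^sub>R f0 \<in> B" using ex by (simp add: B_def)
  then have "B \<noteq> {}" by blast
  moreover have "continuous_on B (\<lambda>f. f \<bullet> (M *v f))"
    by (intro continuous_intros matrix_vector_mult_linear_continuous_on)
  ultimately obtain f where f: "f \<in> B" and min: "\<And>g. g \<in> B \<Longrightarrow> f \<bullet> (M *v f) \<le> g \<bullet> (M *v g)"
    using continuous_attains_inf by metis
  define \<mu> where "\<mu> = f \<bullet> (M *v f)"
  have f1: "f \<bullet> f = 1" and f0: "all_ones \<bullet> f = 0"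
    using f by (simp_all add: B_def norm_eq_1)
  have ge: "\<mu> * (g \<bullet> g) \<le> g \<bullet> (M *v g)" if "all_ones \<bullet> g = 0" for g
  proof (cases "g = 0")
    case False
    have "(1 / norm g) *\<^sub>R g \<in> B" using False that by (simp add: B_def)
    from min[OF this] have "\<mu> \<le> (g \<bullet> (M *v g)) / (norm g)\<^sup>2"
      by (simp add: \<mu>_def matrix_vector_mult_scaleR power2_eq_square)
    then show ?thesis using False by (simp add: pos_le_divide_eq power2_norm_eq_inner)
  qed simp
  define r where "r = M *v f - \<mu> *\<^sub>R f"
  have orth: "g \<bullet> r = 0" if g: "all_ones \<bullet> g = 0" for g
  proof (rule ccontr)
    assume nz: "g \<bullet> r \<noteq> 0"
    define Q where "Q = g \<bullet> (M *v g) - \<mu> * (g \<bullet> g)"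
    have Q: "Q \<ge> 0" using ge[OF g] by (simp add: Q_def)
    have quad: "0 \<le> 2 * t * (g \<bullet> r) + t\<^sup>2 * Q" for t
    proof -
      have "all_ones \<bullet> (f + t *\<^sub>R g) = 0" using f0 g by (simp add: inner_simps)
      note ge[OF this]
      moreover have "f \<bullet> (M *v g) = g \<bullet> (M *v f)"
        by (metis symmetric_inner_commute[OF sym] inner_commute)
      ultimately show ?thesis
        using f1 by (simp add: r_def Q_def \<mu>_def inner_simps matrix_vector_right_distrib
            matrix_vector_mult_scaleR inner_commute[of g f] algebra_simps power2_eq_square)
    qed
    \<comment> \<open>A small step against the sign of the linear term; \<open>Q + 1\<close> avoids dividing by zero.\<close>
    define t where "t = - (g \<bullet> r) / (Q + 1)"
    have gr: "g \<bullet> r = - t * (Q + 1)" using Q by (simp add: t_def)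
    have "2 * t * (g \<bullet> r) + t\<^sup>2 * Q = - (t\<^sup>2 * (Q + 2))"
      unfolding gr by (simp add: algebra_simps power2_eq_square)
    moreover have "t \<noteq> 0" using nz Q by (simp add: t_def)
    then have "t\<^sup>2 * (Q + 2) > 0" using Q by simp
    ultimately show False using quad[of t] by linarith
  qed
  define c where "c = (all_ones \<bullet> r) / (all_ones \<bullet> (all_ones :: real^'n))"
  define x where "x = r - c *\<^sub>R all_ones"
  have x0: "all_ones \<bullet> x = 0"
    using all_ones_nonzero by (simp add: x_def c_def inner_diff_right)
  have "x \<bullet> x = x \<bullet> r - c * (all_ones \<bullet> x)"
    by (subst (2) x_def) (simp add: inner_diff_right inner_commute)
  then have "x = 0" using orth[OF x0] x0 by simp
  then have "r = c *\<^sub>R all_ones" by (simp add: x_def)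
  then have "M *v f = \<mu> *\<^sub>R f + c *\<^sub>R all_ones" by (simp add: r_def algebra_simps)
  moreover have "f \<noteq> 0" using f1 by auto
  ultimately have "\<mu> \<in> compressed_eigenvalues M"
    using f0 by (auto simp: compressed_eigenvalues_def)
  then show thesis using ge that by blast
qed

lemma compressed_eigenvalue_ge:
  assumes "r \<in> compressed_eigenvalues M"
    and "\<And>f. all_ones \<bullet> f = 0 \<Longrightarrow> \<mu> * (f \<bullet> f) \<le> f \<bullet> (M *v f)"
  shows "\<mu> \<le> r"
proof -
  obtain f c where f: "f \<noteq> 0" "all_ones \<bullet> f = 0" "M *v f = r *\<^sub>R f + c *\<^sub>R all_ones"
    using assms(1) by (auto simp: compressed_eigenvalues_def)
  then have "f \<bullet> (M *v f) = r * (f \<bullet> f)" by (simp add: inner_simps inner_commute[of f all_ones])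
  then have "\<mu> * (f \<bullet> f) \<le> r * (f \<bullet> f)" using assms(2) f(2) by metis
  then show ?thesis using f(1) by simp
qed

text \<open>
  On zero-sum vectors the all-ones matrix vanishes, so the distance form is \<open>- 2 (f \<bullet> f) - f \<bullet> A f\<close>
  and its maximum comes from the minimum of the adjacency form.
\<close>

lemma QEC_diameter_two:
  fixes H :: "'v::finite pair_pre_digraph"
  assumes D: "dist_matrix H = 2 *\<^sub>R ones_matrix - 2 *\<^sub>R mat 1 - adj_matrix H"
    and \<mu>: "\<mu> \<in> compressed_eigenvalues (adj_matrix H)"
    and ge: "\<And>f. all_ones \<bullet> f = 0 \<Longrightarrow> \<mu> * (f \<bullet> f) \<le> f \<bullet> (adj_matrix H *v f)"
  shows "QEC H = - 2 - \<mu>"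
proof -
  have form: "f \<bullet> (dist_matrix H *v f) = - 2 * (f \<bullet> f) - f \<bullet> (adj_matrix H *v f)"
    if "all_ones \<bullet> f = 0" for f
    using that unfolding D
    by (simp add: matrix_vector_mult_diff_rdistrib scaleR_matrix_vector_assoc[symmetric]
        ones_matrix_mult inner_simps)
  obtain f c where f: "f \<noteq> 0" "all_ones \<bullet> f = 0" "adj_matrix H *v f = \<mu> *\<^sub>R f + c *\<^sub>R all_ones"
    using \<mu> by (auto simp: compressed_eigenvalues_def)
  define g where "g = (1 / norm f) *\<^sub>R f"
  have "norm g = 1" using f(1) by (simp add: g_def)
  then have g1: "g \<bullet> g = 1" by (simp add: norm_eq_1)
  have g0: "all_ones \<bullet> g = 0" using f(2) by (simp add: g_def)
  have "f \<bullet> (adj_matrix H *v f) = \<mu> * (f \<bullet> f)"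
    using f by (simp add: inner_simps inner_commute[of f all_ones])
  then have "g \<bullet> (adj_matrix H *v g) = \<mu> * (g \<bullet> g)"
    by (simp add: g_def matrix_vector_mult_scaleR)
  then have "g \<bullet> (dist_matrix H *v g) = - 2 - \<mu>" by (simp add: form[OF g0] g1)
  then show ?thesis unfolding QEC_def
  proof (intro Greatest_equality)
    show "- 2 - \<mu> \<in> {f \<bullet> (dist_matrix H *v f) |f. f \<bullet> f = 1 \<and> all_ones \<bullet> f = 0}"
      if "g \<bullet> (dist_matrix H *v g) = - 2 - \<mu>" using that g1 g0 by force
  next
    fix r assume "r \<in> {f \<bullet> (dist_matrix H *v f) |f. f \<bullet> f = 1 \<and> all_ones \<bullet> f = 0}"
    then obtain h where h: "r = h \<bullet> (dist_matrix H *v h)" "h \<bullet> h = 1" "all_ones \<bullet> h = 0" by blast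
    show "r \<le> - 2 - \<mu>" using ge[OF h(3)] form[OF h(3)] h by simp
  qed
qed

text \<open>
  The vector with entries \<open>1, 1, - 2\<close> on an induced path with middle vertex \<open>w\<close> has Rayleigh
  quotient \<open>- 4 / 3\<close>.
\<close>

lemma induced_path_test_vector:
  assumes "pair_graph H" and "u \<noteq> v" and "(u, v) \<notin> parcs H"
    and "(u, w) \<in> parcs H" and "(w, v) \<in> parcs H"
  obtains f where "f \<noteq> 0" and "all_ones \<bullet> f = 0"
    and "f \<bullet> (adj_matrix H *v f) = - (4 / 3) * (f \<bullet> f)"
proof -
  interpret pair_graph H by fact
  have sym: "(b, a) \<in> parcs H \<longleftrightarrow> (a, b) \<in> parcs H" for a b
    using pair_sym_arcs by (auto simp: symmetric_def sym_def)
  have irr: "(a, a) \<notin> parcs H" for a using pair_no_loops by fastforce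
  have ne: "u \<noteq> w" "w \<noteq> v" using assms irr by auto
  define f where "f = axis u 1 + axis v 1 - 2 *\<^sub>R axis w (1::real)"
  have "f $ u = 1" using assms(2) ne by (simp add: f_def axis_def)
  then have "f \<noteq> 0" by auto
  moreover have "all_ones \<bullet> f = 0"
    by (simp add: f_def inner_simps inner_axis all_ones_def)
  moreover have "f \<bullet> f = 6"
    using assms(2) ne by (simp add: f_def inner_simps inner_axis_axis)
  moreover have "f \<bullet> (adj_matrix H *v f) = - 8"
    using assms sym[of u v] sym[of u w] sym[of w v] irr
    by (simp add: f_def matrix_vector_right_distrib matrix_vector_mult_diff_distrib
        matrix_vector_mult_scaleR matrix_vector_mult_basis column_def adj_matrix_def
        inner_simps inner_axis')
  ultimately show thesis using that by simp
qed

section \<open>Reduction to one coordinate per part\<close>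

text \<open>
  The equation \<open>B f = r f + c e\<close>, with \<open>B\<close> the adjacency matrix of the join and \<open>f\<close> a nonzero
  zero-sum vector, written out for the \<open>f\<close> that is \<open>\<xi> j\<close> on part \<open>j\<close> of the multipartite factor
  and \<open>y\<close> on the other factor, whose adjacency matrix is \<open>A\<close>.
\<close>

definition join_solution ::
  "real^'v^'v::finite \<Rightarrow> nat \<Rightarrow> (nat \<Rightarrow> nat) \<Rightarrow> real \<Rightarrow> (nat \<Rightarrow> real) \<Rightarrow> real^'v \<Rightarrow> real \<Rightarrow> bool" where
  "join_solution A k m r \<xi> y c \<longleftrightarrow>
     ((\<exists>j\<in>{1..k}. \<xi> j \<noteq> 0) \<or> y \<noteq> 0) \<and>
     (\<forall>j\<in>{1..k}. (r + real (m j)) * \<xi> j = - c) \<and>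
     A *v y = r *\<^sub>R y + (c - (\<Sum>j=1..k. real (m j) * \<xi> j)) *\<^sub>R all_ones \<and>
     all_ones \<bullet> y = - (\<Sum>j=1..k. real (m j) * \<xi> j)"

lemma sum_UNIV_sum_type:
  "(\<Sum>z\<in>(UNIV :: ('w::finite + 'v::finite) set). g z) = (\<Sum>w\<in>UNIV. g (Inl w)) + (\<Sum>v\<in>UNIV. g (Inr v))"
  by (simp add: UNIV_Plus_UNIV[symmetric] sum.Plus del: UNIV_Plus_UNIV)

lemma graph_join_arcs [simp]:
  "(Inl u, Inl u') \<in> parcs (graph_join K G) \<longleftrightarrow> (u, u') \<in> parcs K"
  "(Inr v, Inr v') \<in> parcs (graph_join K G) \<longleftrightarrow> (v, v') \<in> parcs G"
  "(Inl u, Inr v) \<in> parcs (graph_join K G) \<longleftrightarrow> u \<in> pverts K \<and> v \<in> pverts G"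
  "(Inr v, Inl u) \<in> parcs (graph_join K G) \<longleftrightarrow> u \<in> pverts K \<and> v \<in> pverts G"
  by (auto simp: graph_join_def)

lemma adj_matrix_join_mult:
  fixes K :: "'w::finite pair_pre_digraph" and G :: "'v::finite pair_pre_digraph"
  assumes "pverts K = UNIV" "pverts G = UNIV"
  shows "(adj_matrix (graph_join K G) *v f) $ Inl w
           = (adj_matrix K *v (\<chi> u. f $ Inl u)) $ w + (\<Sum>v\<in>UNIV. f $ Inr v)"
    and "(adj_matrix (graph_join K G) *v f) $ Inr v
           = (\<Sum>w\<in>UNIV. f $ Inl w) + (adj_matrix G *v (\<chi> u. f $ Inr u)) $ v"
  using assms by (simp_all add: adj_matrix_def matrix_vector_mult_def sum_UNIV_sum_type)

text \<open>
  On part \<open>j\<close> the adjacency matrix of the join maps a zero-sum vector to minus its sum over that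
  part, a constant. For \<open>r \<noteq> 0\<close> the eigenvalue equation therefore forces the vector itself to be
  constant on each part.
\<close>

lemma compressed_eigenvalue_join_iff:
  fixes K :: "'w::finite pair_pre_digraph" and G :: "'v::finite pair_pre_digraph"
  assumes K: "complete_multipartite K k m" "pverts K = UNIV" and G: "pverts G = UNIV"
    and r: "r \<noteq> 0"
  shows "r \<in> compressed_eigenvalues (adj_matrix (graph_join K G)) \<longleftrightarrow>
    (\<exists>\<xi> y c. join_solution (adj_matrix G) k m r \<xi> y c)"
proof -
  obtain V where V: "UNIV = (\<Union>j\<in>{1..k}. V j)" "disjoint_family_on V {1..k}"
    "\<And>j. j \<in> {1..k} \<Longrightarrow> card (V j) = m j \<and> m j \<ge> 1"
    "parcs K = {(u, v). \<exists>j\<in>{1..k}. \<exists>l\<in>{1..k}. j \<noteq> l \<and> u \<in> V j \<and> v \<in> V l}"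
    using K by (auto simp: complete_multipartite_def)
  have "\<forall>w. \<exists>j\<in>{1..k}. w \<in> V j" using V(1) by blast
  then obtain part where part: "\<And>w. part w \<in> {1..k}" "\<And>w. w \<in> V (part w)" by metis
  have uniq: "j = l" if "w \<in> V j" "w \<in> V l" "j \<in> {1..k}" "l \<in> {1..k}" for w j l
    using V(2) that unfolding disjoint_family_on_def by blast
  have partI: "part w = j" if "j \<in> {1..k}" "w \<in> V j" for w j
    using uniq[OF part(2) that(2) part(1) that(1)] .
  have arc: "(w, u) \<in> parcs K \<longleftrightarrow> u \<notin> V (part w)" for w u
    unfolding V(4) using part uniq by (smt (verit) case_prodI case_prodD mem_Collect_eq)
  have sum_parts: "(\<Sum>w\<in>UNIV. g w) = (\<Sum>j=1..k. \<Sum>w\<in>V j. g w)" for g :: "'w \<Rightarrow> real"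
    unfolding V(1) by (rule sum.UNION_disjoint)
      (use V(2) in \<open>auto simp: disjoint_family_on_def\<close>)
  have AK: "(adj_matrix K *v x) $ w = (\<Sum>u\<in>UNIV. x $ u) - (\<Sum>u\<in>V (part w). x $ u)" for x w
  proof -
    have "(adj_matrix K *v x) $ w = (\<Sum>u\<in>UNIV. if u \<in> V (part w) then 0 else x $ u)"
      by (auto simp: adj_matrix_def matrix_vector_mult_def arc intro!: sum.cong)
    also have "\<dots> = (\<Sum>u\<in>UNIV - V (part w). x $ u)"
      by (intro sum.mono_neutral_cong_right) auto
    also have "\<dots> = (\<Sum>u\<in>UNIV. x $ u) - (\<Sum>u\<in>V (part w). x $ u)"
      by (intro sum_diff) auto
    finally show ?thesis .
  qed
  show ?thesis
  proof
    assume "r \<in> compressed_eigenvalues (adj_matrix (graph_join K G))"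
    then obtain f c where f: "f \<noteq> 0" "all_ones \<bullet> f = 0"
      "adj_matrix (graph_join K G) *v f = r *\<^sub>R f + c *\<^sub>R all_ones"
      by (auto simp: compressed_eigenvalues_def)
    define y :: "real^'v" where "y = (\<chi> v. f $ Inr v)"
    define \<xi> where "\<xi> j = - (c + (\<Sum>u\<in>V j. f $ Inl u)) / r" for j
    have total: "(\<Sum>w\<in>UNIV. f $ Inl w) + (\<Sum>v\<in>UNIV. f $ Inr v) = 0"
      using f(2) by (simp add: inner_all_ones sum_UNIV_sum_type)
    have const: "f $ Inl w = \<xi> (part w)" for w
    proof -
      have "- (\<Sum>u\<in>V (part w). f $ Inl u) = (adj_matrix (graph_join K G) *v f) $ Inl w"
        using total by (simp add: adj_matrix_join_mult[OF K(2) G] AK)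
      also have "\<dots> = r * f $ Inl w + c" unfolding f(3) by (simp add: all_ones_def)
      finally show ?thesis using r by (simp add: \<xi>_def field_simps)
    qed
    have part_sum: "(\<Sum>u\<in>V j. f $ Inl u) = real (m j) * \<xi> j" if j: "j \<in> {1..k}" for j
      using V(3)[OF j] partI[OF j] by (simp add: const)
    then have s: "(\<Sum>w\<in>UNIV. f $ Inl w) = (\<Sum>j=1..k. real (m j) * \<xi> j)"
      by (simp add: sum_parts)
    have "(r + real (m j)) * \<xi> j = - c" if j: "j \<in> {1..k}" for j
    proof -
      have "r * \<xi> j = - (c + (\<Sum>u\<in>V j. f $ Inl u))" using r by (simp add: \<xi>_def)
      then show ?thesis using part_sum[OF j] by (simp add: algebra_simps)
    qed
    moreover have "adj_matrix G *v y = r *\<^sub>R y + (c - (\<Sum>j=1..k. real (m j) * \<xi> j)) *\<^sub>R all_ones"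
    proof (subst vec_eq_iff, intro allI)
      fix v
      have "(\<Sum>w\<in>UNIV. f $ Inl w) + (adj_matrix G *v y) $ v
          = (adj_matrix (graph_join K G) *v f) $ Inr v"
        by (simp add: adj_matrix_join_mult[OF K(2) G] y_def)
      also have "\<dots> = r * y $ v + c" unfolding f(3) by (simp add: all_ones_def y_def)
      finally show "(adj_matrix G *v y) $ v
          = (r *\<^sub>R y + (c - (\<Sum>j=1..k. real (m j) * \<xi> j)) *\<^sub>R all_ones) $ v"
        using s by (simp add: all_ones_def)
    qed
    moreover have "all_ones \<bullet> y = - (\<Sum>j=1..k. real (m j) * \<xi> j)"
      using total s by (simp add: inner_all_ones y_def)
    moreover have "(\<exists>j\<in>{1..k}. \<xi> j \<noteq> 0) \<or> y \<noteq> 0"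
    proof (rule ccontr)
      assume "\<not> ?thesis"
      then have "f $ z = 0" for z
        using const part(1) by (cases z) (auto simp: y_def vec_eq_iff)
      then show False using f(1) by (simp add: vec_eq_iff)
    qed
    ultimately show "\<exists>\<xi> y c. join_solution (adj_matrix G) k m r \<xi> y c"
      unfolding join_solution_def by blast
  next
    assume "\<exists>\<xi> y c. join_solution (adj_matrix G) k m r \<xi> y c"
    then obtain \<xi> y c where nz: "(\<exists>j\<in>{1..k}. \<xi> j \<noteq> 0) \<or> y \<noteq> 0"
      and eqK: "\<And>j. j \<in> {1..k} \<Longrightarrow> (r + real (m j)) * \<xi> j = - c"
      and eqG: "adj_matrix G *v y = r *\<^sub>R y + (c - (\<Sum>j=1..k. real (m j) * \<xi> j)) *\<^sub>R all_ones"
      and sum_y: "all_ones \<bullet> y = - (\<Sum>j=1..k. real (m j) * \<xi> j)"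
      unfolding join_solution_def by blast
    define f :: "real^('w + 'v)"
      where "f = (\<chi> z. case z of Inl w \<Rightarrow> \<xi> (part w) | Inr v \<Rightarrow> y $ v)"
    have f_simps: "f $ Inl w = \<xi> (part w)" "f $ Inr v = y $ v" for w v
      by (simp_all add: f_def)
    have part_sum: "(\<Sum>u\<in>V j. f $ Inl u) = real (m j) * \<xi> j" if j: "j \<in> {1..k}" for j
      using V(3)[OF j] partI[OF j] by (simp add: f_simps)
    then have s: "(\<Sum>w\<in>UNIV. f $ Inl w) = (\<Sum>j=1..k. real (m j) * \<xi> j)"
      by (simp add: sum_parts)
    have sum_Inr: "(\<Sum>v\<in>UNIV. f $ Inr v) = - (\<Sum>j=1..k. real (m j) * \<xi> j)"
      using sum_y by (simp add: inner_all_ones f_simps)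
    have "all_ones \<bullet> f = 0"
      using s sum_Inr by (simp add: inner_all_ones sum_UNIV_sum_type)
    moreover have "f \<noteq> 0"
    proof
      assume "f = 0"
      then have "\<xi> (part w) = 0" "y $ v = 0" for w v
        using f_simps(1)[of w] f_simps(2)[of v] by auto
      moreover have "\<exists>w. part w = j" if "j \<in> {1..k}" for j
      proof -
        have "V j \<noteq> {}" using V(3)[OF that] by auto
        then show ?thesis using partI[OF that] by blast
      qed
      ultimately show False using nz by (metis vec_eq_iff zero_index)
    qed
    moreover have "adj_matrix (graph_join K G) *v f = r *\<^sub>R f + c *\<^sub>R all_ones"
    proof (subst vec_eq_iff, intro allI)
      fix z
      show "(adj_matrix (graph_join K G) *v f) $ z = (r *\<^sub>R f + c *\<^sub>R all_ones) $ z"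
      proof (cases z)
        case (Inl w)
        have "(adj_matrix (graph_join K G) *v f) $ Inl w = - (real (m (part w)) * \<xi> (part w))"
          using s sum_Inr part_sum[OF part(1), of w]
          by (simp add: adj_matrix_join_mult[OF K(2) G] AK)
        then show ?thesis
          using eqK[OF part(1), of w] by (simp add: Inl f_simps all_ones_def algebra_simps)
      next
        case (Inr v)
        have "(\<chi> u. f $ Inr u) = y" by (simp add: f_simps vec_eq_iff)
        then show ?thesis using s eqG
          by (simp add: Inr adj_matrix_join_mult[OF K(2) G] f_simps all_ones_def)
      qed
    qed
    ultimately show "r \<in> compressed_eigenvalues (adj_matrix (graph_join K G))"
      by (auto simp: compressed_eigenvalues_def)
  qed
qed

section \<open>Solving the reduced equations\<close>

text \<open>Two parts of equal size carry the vector that is \<open>1\<close> on one and \<open>- 1\<close> on the other.\<close>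

lemma join_solution_repeated_part:
  assumes "j \<in> {1..k}" "l \<in> {1..k}" "j \<noteq> l" "m j = m l"
  shows "\<exists>\<xi> y c. join_solution A k m (- real (m j)) \<xi> y c"
proof -
  define \<xi> :: "nat \<Rightarrow> real" where "\<xi> = (\<lambda>n. if n = j then 1 else if n = l then - 1 else 0)"
  have "(\<Sum>n=1..k. real (m n) * \<xi> n)
      = (\<Sum>n=1..k. (if n = j then real (m j) else 0) - (if n = l then real (m l) else 0))"
    using assms(3) by (intro sum.cong) (auto simp: \<xi>_def)
  also have "\<dots> = 0" using assms by (simp add: sum_subtractf)
  finally have "join_solution A k m (- real (m j)) \<xi> 0 0"
    using assms unfolding join_solution_def by (auto simp: \<xi>_def)
  then show ?thesis by blast
qed

text \<open>
  If part \<open>j\<close> is the only one of size \<open>- r\<close>, its equation gives \<open>c = 0\<close> and the other parts carry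
  zero. What is left is \<open>A y = r y - s e\<close> with \<open>s = - \<langle>e, y\<rangle>\<close>, the eigenvalue equation of \<open>A - J\<close>.
\<close>

lemma join_solution_simple_part_iff:
  assumes j: "j \<in> {1..k}" and m: "m j \<ge> 1"
    and only: "\<And>l. l \<in> {1..k} \<Longrightarrow> m l = m j \<Longrightarrow> l = j"
  shows "(\<exists>\<xi> y c. join_solution A k m (- real (m j)) \<xi> y c) \<longleftrightarrow>
    - real (m j) \<in> eigenvalues (A - ones_matrix)"
proof
  assume "\<exists>\<xi> y c. join_solution A k m (- real (m j)) \<xi> y c"
  then obtain \<xi> y c where nz: "(\<exists>l\<in>{1..k}. \<xi> l \<noteq> 0) \<or> y \<noteq> 0"
    and eqK: "\<And>l. l \<in> {1..k} \<Longrightarrow> (- real (m j) + real (m l)) * \<xi> l = - c"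
    and eqG: "A *v y = (- real (m j)) *\<^sub>R y + (c - (\<Sum>l=1..k. real (m l) * \<xi> l)) *\<^sub>R all_ones"
    and sum_y: "all_ones \<bullet> y = - (\<Sum>l=1..k. real (m l) * \<xi> l)"
    unfolding join_solution_def by blast
  have c: "c = 0" using eqK[OF j] by simp
  have zero: "\<xi> l = 0" if "l \<in> {1..k}" "l \<noteq> j" for l
    using eqK[OF that(1)] only[OF that(1)] that(2) c by auto
  have "(\<Sum>l=1..k. real (m l) * \<xi> l) = (\<Sum>l\<in>{j}. real (m l) * \<xi> l)"
    using j zero by (intro sum.mono_neutral_right) auto
  then have s: "all_ones \<bullet> y = - (real (m j) * \<xi> j)" using sum_y by simp
  have "y \<noteq> 0"
  proof
    assume "y = 0"
    then have "\<xi> j = 0" using s m by simp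
    then show False using nz zero \<open>y = 0\<close> by metis
  qed
  moreover have "(A - ones_matrix) *v y = (- real (m j)) *\<^sub>R y"
    unfolding matrix_vector_mult_diff_rdistrib ones_matrix_mult eqG sum_y c
    by (simp add: algebra_simps)
  ultimately show "- real (m j) \<in> eigenvalues (A - ones_matrix)"
    unfolding eigenvalues_def by blast
next
  assume "- real (m j) \<in> eigenvalues (A - ones_matrix)"
  then obtain y where y: "y \<noteq> 0" "(A - ones_matrix) *v y = (- real (m j)) *\<^sub>R y"
    unfolding eigenvalues_def by blast
  define \<xi> where "\<xi> = (\<lambda>l. if l = j then - (all_ones \<bullet> y) / real (m j) else 0)"
  have "(\<Sum>l=1..k. real (m l) * \<xi> l) = (\<Sum>l\<in>{j}. real (m l) * \<xi> l)"
    using j by (intro sum.mono_neutral_right) (auto simp: \<xi>_def)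
  then have s: "(\<Sum>l=1..k. real (m l) * \<xi> l) = - (all_ones \<bullet> y)"
    using m by (simp add: \<xi>_def)
  have "A *v y = (- real (m j)) *\<^sub>R y + (all_ones \<bullet> y) *\<^sub>R all_ones"
    using y(2) by (simp add: matrix_vector_mult_diff_rdistrib ones_matrix_mult algebra_simps)
  then have "join_solution A k m (- real (m j)) \<xi> y 0"
    unfolding join_solution_def using y(1) s by (auto simp: \<xi>_def)
  then show "\<exists>\<xi> y c. join_solution A k m (- real (m j)) \<xi> y c" by blast
qed

text \<open>
  Away from the values \<open>- m j\<close> the multiplier \<open>c\<close> determines \<open>\<xi>\<close>. The sum of the vector over the
  multipartite factor is then \<open>- c (P - 1)\<close>, where \<open>P\<close> is the rational function of the theorem.
\<close>

lemma join_solution_nonpole_iff: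
  assumes nonpole: "\<And>j. j \<in> {1..k} \<Longrightarrow> r + real (m j) \<noteq> 0"
    and P: "P = 1 + (\<Sum>j=1..k. real (m j) / (r + real (m j)))"
  shows "(\<exists>\<xi> y c. join_solution A k m r \<xi> y c) \<longleftrightarrow>
    (\<exists>y c. (c \<noteq> 0 \<or> y \<noteq> 0) \<and> A *v y = r *\<^sub>R y + (c * P) *\<^sub>R all_ones \<and> all_ones \<bullet> y = c * (P - 1))"
proof -
  have s: "(\<Sum>j=1..k. real (m j) * (- c / (r + real (m j)))) = - c * (P - 1)" for c
    unfolding P by (simp add: sum_distrib_left sum_negf mult.commute)
  show ?thesis
  proof
    assume "\<exists>\<xi> y c. join_solution A k m r \<xi> y c"
    then obtain \<xi> y c where nz: "(\<exists>l\<in>{1..k}. \<xi> l \<noteq> 0) \<or> y \<noteq> 0"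
      and eqK: "\<And>l. l \<in> {1..k} \<Longrightarrow> (r + real (m l)) * \<xi> l = - c"
      and eqG: "A *v y = r *\<^sub>R y + (c - (\<Sum>l=1..k. real (m l) * \<xi> l)) *\<^sub>R all_ones"
      and sum_y: "all_ones \<bullet> y = - (\<Sum>l=1..k. real (m l) * \<xi> l)"
      unfolding join_solution_def by blast
    have \<xi>: "\<xi> l = - c / (r + real (m l))" if "l \<in> {1..k}" for l
      using eqK[OF that] nonpole[OF that] by (simp add: field_simps)
    have "(\<Sum>l=1..k. real (m l) * \<xi> l) = (\<Sum>l=1..k. real (m l) * (- c / (r + real (m l))))"
      by (intro sum.cong) (simp_all add: \<xi>)
    then have "(\<Sum>l=1..k. real (m l) * \<xi> l) = - c * (P - 1)" using s by simp
    then have "A *v y = r *\<^sub>R y + (c - - c * (P - 1)) *\<^sub>R all_ones"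
      and "all_ones \<bullet> y = - (- c * (P - 1))"
      using eqG sum_y by metis+
    then have "A *v y = r *\<^sub>R y + (c * P) *\<^sub>R all_ones" "all_ones \<bullet> y = c * (P - 1)"
      by (simp_all add: algebra_simps)
    moreover have "c \<noteq> 0 \<or> y \<noteq> 0" using nz \<xi> by auto
    ultimately show "\<exists>y c. (c \<noteq> 0 \<or> y \<noteq> 0) \<and> A *v y = r *\<^sub>R y + (c * P) *\<^sub>R all_ones
        \<and> all_ones \<bullet> y = c * (P - 1)" by blast
  next
    assume "\<exists>y c. (c \<noteq> 0 \<or> y \<noteq> 0) \<and> A *v y = r *\<^sub>R y + (c * P) *\<^sub>R all_ones
        \<and> all_ones \<bullet> y = c * (P - 1)"
    then obtain y c where y: "c \<noteq> 0 \<or> y \<noteq> 0" "A *v y = r *\<^sub>R y + (c * P) *\<^sub>R all_ones"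
      "all_ones \<bullet> y = c * (P - 1)" by blast
    define \<xi> where "\<xi> = (\<lambda>l. - c / (r + real (m l)))"
    have "(\<exists>l\<in>{1..k}. \<xi> l \<noteq> 0) \<or> y \<noteq> 0"
    proof (cases "y = 0")
      case True
      \<comment> \<open>With no parts at all, \<open>P = 1\<close> and the equation \<open>0 = c e\<close> would force \<open>c = 0\<close>.\<close>
      have "k \<ge> 1"
      proof (rule ccontr)
        assume "\<not> k \<ge> 1"
        then have "P = 1" by (simp add: P)
        then show False using y True all_ones_nonzero by auto
      qed
      then have "1 \<in> {1..k}" by simp
      moreover have "\<xi> 1 \<noteq> 0" using nonpole[OF \<open>1 \<in> {1..k}\<close>] y(1) True by (simp add: \<xi>_def)
      ultimately show ?thesis by blast
    qed simp
    moreover have "(r + real (m l)) * \<xi> l = - c" if "l \<in> {1..k}" for l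
      using nonpole[OF that] by (simp add: \<xi>_def)
    moreover have sum: "(\<Sum>l=1..k. real (m l) * \<xi> l) = - c * (P - 1)" using s by (simp add: \<xi>_def)
    then have "c - (\<Sum>l=1..k. real (m l) * \<xi> l) = c * P" by (simp add: algebra_simps)
    ultimately have "join_solution A k m r \<xi> y c"
      unfolding join_solution_def using y(2,3) sum by simp
    then show "\<exists>\<xi> y c. join_solution A k m r \<xi> y c" by blast
  qed
qed

lemma join_solution_zero_iff:
  assumes "\<And>j. j \<in> {1..k} \<Longrightarrow> r + real (m j) \<noteq> 0"
    and "1 + (\<Sum>j=1..k. real (m j) / (r + real (m j))) = 0"
  shows "(\<exists>\<xi> y c. join_solution A k m r \<xi> y c) \<longleftrightarrow> r \<in> eigenvalues A"
proof -
  have "(\<exists>\<xi> y c. join_solution A k m r \<xi> y c) \<longleftrightarrow>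
    (\<exists>y c. (c \<noteq> 0 \<or> y \<noteq> 0) \<and> A *v y = r *\<^sub>R y \<and> all_ones \<bullet> y = - c)"
    using join_solution_nonpole_iff[where P = 0, OF assms(1) assms(2)[symmetric]] by simp
  also have "\<dots> \<longleftrightarrow> (\<exists>y. y \<noteq> 0 \<and> A *v y = r *\<^sub>R y)"
    by (metis inner_zero_right neg_equal_0_iff_equal minus_minus)
  finally show ?thesis by (simp add: eigenvalues_def)
qed

lemma noneigenvalue_invertible:
  fixes A :: "real^'n::finite^'n"
  assumes "r \<notin> eigenvalues A"
  shows "invertible (A - r *\<^sub>R mat 1)"
proof -
  have "x = 0" if "(A - r *\<^sub>R mat 1) *v x = 0" for x
    using assms that
    by (auto simp: eigenvalues_def matrix_vector_mult_diff_rdistrib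
        scaleR_matrix_vector_assoc[symmetric])
  then show ?thesis
    using matrix_left_invertible_ker invertible_left_inverse by blast
qed

lemma matrix_inv_inverse:
  fixes A :: "real^'n::finite^'n"
  assumes "invertible A"
  shows "A ** matrix_inv A = mat 1" "matrix_inv A ** A = mat 1"
  using assms someI_ex[of "\<lambda>B. A ** B = mat 1 \<and> B ** A = mat 1"]
  unfolding invertible_def matrix_inv_def by blast+

text \<open>
  A solution with \<open>c = 0\<close> is an eigenvector of \<open>A\<close> orthogonal to \<open>e\<close>. If \<open>c \<noteq> 0\<close> and \<open>r\<close> is an
  eigenvalue of \<open>A\<close>, pairing the equation with an eigenvector shows, since \<open>P \<noteq> 0\<close>, that this
  eigenvector is orthogonal to \<open>e\<close>. If \<open>r\<close> is no eigenvalue, the resolvent gives \<open>y\<close>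
  and the sum condition becomes the scalar equation.
\<close>

lemma join_solution_nonzero_iff:
  fixes A :: "real^'v::finite^'v"
  assumes sym: "transpose A = A"
    and nonpole: "\<And>j. j \<in> {1..k} \<Longrightarrow> r + real (m j) \<noteq> 0"
    and P: "P = 1 + (\<Sum>j=1..k. real (m j) / (r + real (m j)))" and "P \<noteq> 0"
  shows "(\<exists>\<xi> y c. join_solution A k m r \<xi> y c) \<longleftrightarrow> r \<in> eigenvalues0 A \<or>
    r \<notin> eigenvalues A \<and> P * (all_ones \<bullet> (matrix_inv (A - r *\<^sub>R mat 1) *v all_ones)) = P - 1"
    (is "?sol \<longleftrightarrow> _ \<or> _ \<and> P * (all_ones \<bullet> (?R *v all_ones)) = P - 1")
proof -
  have sol: "?sol \<longleftrightarrow> (\<exists>y c. (c \<noteq> 0 \<or> y \<noteq> 0) \<and>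
      A *v y = r *\<^sub>R y + (c * P) *\<^sub>R all_ones \<and> all_ones \<bullet> y = c * (P - 1))"
    by (rule join_solution_nonpole_iff[OF nonpole P])
  have shift: "(A - r *\<^sub>R mat 1) *v y = A *v y - r *\<^sub>R y" for y
    by (simp add: matrix_vector_mult_diff_rdistrib scaleR_matrix_vector_assoc[symmetric])
  show ?thesis
  proof
    assume ?sol
    then obtain y c where nz: "c \<noteq> 0 \<or> y \<noteq> 0"
      and y: "A *v y = r *\<^sub>R y + (c * P) *\<^sub>R all_ones" "all_ones \<bullet> y = c * (P - 1)"
      unfolding sol by blast
    show "r \<in> eigenvalues0 A \<or> r \<notin> eigenvalues A \<and> P * (all_ones \<bullet> (?R *v all_ones)) = P - 1"
    proof (cases "c = 0")
      case True
      then have "y \<noteq> 0 \<and> A *v y = r *\<^sub>R y \<and> all_ones \<bullet> y = 0" using nz y by simp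
      then show ?thesis unfolding eigenvalues0_def by blast
    next
      case c: False
      show ?thesis
      proof (cases "r \<in> eigenvalues A")
        case True
        then obtain x where x: "x \<noteq> 0" "A *v x = r *\<^sub>R x" unfolding eigenvalues_def by blast
        have "(A *v y) \<bullet> x = y \<bullet> (A *v x)" by (rule symmetric_inner_commute[OF sym])
        then have "(c * P) * (all_ones \<bullet> x) = 0" unfolding x(2) y(1) by (simp add: inner_simps)
        then have "all_ones \<bullet> x = 0" using c \<open>P \<noteq> 0\<close> by simp
        then show ?thesis using x unfolding eigenvalues0_def by blast
      next
        case False
        have "y = ?R *v ((A - r *\<^sub>R mat 1) *v y)"
          using matrix_inv_inverse(2)[OF noneigenvalue_invertible[OF False]]
          by (simp add: matrix_vector_mul_assoc)
        also have "\<dots> = (c * P) *\<^sub>R (?R *v all_ones)"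
          by (simp add: shift y matrix_vector_mult_scaleR)
        finally have "c * (P * (all_ones \<bullet> (?R *v all_ones))) = c * (P - 1)"
          using y(2) by (metis inner_scaleR_right mult.assoc)
        then show ?thesis using c False by simp
      qed
    qed
  next
    assume "r \<in> eigenvalues0 A \<or>
      r \<notin> eigenvalues A \<and> P * (all_ones \<bullet> (?R *v all_ones)) = P - 1"
    then show ?sol
    proof
      assume "r \<in> eigenvalues0 A"
      then obtain x where "x \<noteq> 0" "A *v x = r *\<^sub>R x" "all_ones \<bullet> x = 0"
        unfolding eigenvalues0_def by blast
      then show ?sol unfolding sol by (intro exI[of _ x] exI[of _ 0]) simp
    next
      assume *: "r \<notin> eigenvalues A \<and> P * (all_ones \<bullet> (?R *v all_ones)) = P - 1"
      define y where "y = P *\<^sub>R (?R *v all_ones)"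
      have "(A - r *\<^sub>R mat 1) *v (?R *v all_ones) = all_ones"
        using matrix_inv_inverse(1)[OF noneigenvalue_invertible[OF conjunct1[OF *]]]
        by (simp add: matrix_vector_mul_assoc)
      then have "(A - r *\<^sub>R mat 1) *v y = P *\<^sub>R all_ones"
        by (simp add: y_def matrix_vector_mult_scaleR)
      then have "A *v y = r *\<^sub>R y + P *\<^sub>R all_ones" unfolding shift by (simp add: diff_eq_eq add.commute)
      moreover have "all_ones \<bullet> y = P - 1" using * by (simp add: y_def)
      ultimately show ?sol unfolding sol by (intro exI[of _ y] exI[of _ 1]) simp
    qed
  qed
qed

section \<open>The quadratic embedding constant of the join\<close>

lemma complete_multipartite_pair_graph:
  fixes K :: "'w::finite pair_pre_digraph"
  assumes "complete_multipartite K k m"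
  shows "pair_graph K"
proof -
  obtain V where "pverts K = (\<Union>j\<in>{1..k}. V j)" "disjoint_family_on V {1..k}"
    "parcs K = {(u, v). \<exists>j\<in>{1..k}. \<exists>l\<in>{1..k}. j \<noteq> l \<and> u \<in> V j \<and> v \<in> V l}"
    using assms by (auto simp: complete_multipartite_def)
  note V = this
  show ?thesis
  proof unfold_locales
    have arc: "\<exists>j\<in>{1..k}. \<exists>l\<in>{1..k}. j \<noteq> l \<and> u \<in> V j \<and> v \<in> V l" if "(u, v) \<in> parcs K" for u v
      using that by (simp add: V(3))
    show "fst e \<noteq> snd e" if e: "e \<in> parcs K" for e
    proof
      assume "fst e = snd e"
      then obtain j l where "j \<in> {1..k}" "l \<in> {1..k}" "j \<noteq> l" "fst e \<in> V j" "fst e \<in> V l"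
        using arc[of "fst e" "snd e"] e by (metis prod.collapse)
      then show False using V(2) unfolding disjoint_family_on_def by blast
    qed
    have "sym (parcs K)"
    proof (rule symI)
      fix u v assume "(u, v) \<in> parcs K"
      then have "\<exists>j\<in>{1..k}. \<exists>l\<in>{1..k}. j \<noteq> l \<and> v \<in> V j \<and> u \<in> V l" using arc by metis
      then show "(v, u) \<in> parcs K" by (simp add: V(3))
    qed
    then show "symmetric (with_proj K)" by (simp add: symmetric_def)
  qed (use V(1) in \<open>auto simp: V(3)\<close>)
qed

lemma graph_join_pair_graph:
  fixes K :: "'w::finite pair_pre_digraph" and G :: "'v::finite pair_pre_digraph"
  assumes "pair_graph K" "pair_graph G"
  shows "pair_graph (graph_join K G)"
proof -
  interpret K: pair_graph K by fact
  interpret G: pair_graph G by fact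
  have symK: "sym (parcs K)" and symG: "sym (parcs G)"
    using K.pair_sym_arcs G.pair_sym_arcs by (simp_all add: symmetric_def)
  show ?thesis
  proof unfold_locales
    show "fst e \<in> pverts (graph_join K G)" if "e \<in> parcs (graph_join K G)" for e
      using that by (auto simp: graph_join_def dest: K.in_arcsD1 G.in_arcsD1)
    show "snd e \<in> pverts (graph_join K G)" if "e \<in> parcs (graph_join K G)" for e
      using that by (auto simp: graph_join_def dest: K.in_arcsD2 G.in_arcsD2)
    show "fst e \<noteq> snd e" if "e \<in> parcs (graph_join K G)" for e
      using that by (auto simp: graph_join_def dest: K.pair_no_loops G.pair_no_loops)
    show "symmetric (with_proj (graph_join K G))"
      using symK symG by (auto simp: symmetric_def graph_join_def sym_def)
  qed simp_all
qed

text \<open>Two nonadjacent vertices lie in the same factor, so any vertex of the other one will do.\<close>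

lemma graph_join_common_neighbour:
  fixes K :: "'w pair_pre_digraph" and G :: "'v pair_pre_digraph"
  assumes "pverts K = UNIV" "pverts G = UNIV" and "(u, v) \<notin> parcs (graph_join K G)"
  shows "\<exists>w. (u, w) \<in> parcs (graph_join K G) \<and> (w, v) \<in> parcs (graph_join K G)"
proof (cases u)
  case (Inl x)
  then show ?thesis using assms
    by (cases v) (auto intro: exI[of _ "Inr undefined"])
next
  case (Inr x)
  then show ?thesis using assms
    by (cases v) (auto intro: exI[of _ "Inl undefined"])
qed

lemma sum_grouped_by_value:
  fixes g :: "nat \<Rightarrow> real"
  assumes "bij_betw (\<lambda>p. m (i p)) {1..q::nat} (m ` {1..k::nat})"
    and "\<forall>p\<in>{1..q}. a p = card {j\<in>{1..k}. m j = m (i p)}"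
  shows "(\<Sum>p=1..q. real (a p) * g (m (i p))) = (\<Sum>j=1..k. g (m j))"
proof -
  have "(\<Sum>j=1..k. g (m j)) = (\<Sum>x\<in>m ` {1..k}. \<Sum>j\<in>{j\<in>{1..k}. m j = x}. g (m j))"
    by (rule sum.image_gen) simp
  also have "\<dots> = (\<Sum>x\<in>m ` {1..k}. real (card {j\<in>{1..k}. m j = x}) * g x)"
    by (intro sum.cong) simp_all
  also have "\<dots> = (\<Sum>p=1..q. real (card {j\<in>{1..k}. m j = m (i p)}) * g (m (i p)))"
    by (rule sum.reindex_bij_betw[OF assms(1), symmetric])
  also have "\<dots> = (\<Sum>p=1..q. real (a p) * g (m (i p)))"
    using assms(2) by (intro sum.cong) simp_all
  finally show ?thesis by simp
qed


theorem theorem1p2: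
  fixes K :: "'w::finite pair_pre_digraph" and G :: "'v::finite pair_pre_digraph"
    and k q :: nat and m i a :: "nat \<Rightarrow> nat"
  assumes "pair_graph G" and "pverts G = UNIV"
    and "complete_multipartite K k m" and "pverts K = UNIV"
    and "\<not> complete_digraph (card (pverts (graph_join K G))) (with_proj (graph_join K G))"
    and "i ` {1..q} \<subseteq> {1..k}"
    and "bij_betw (\<lambda>p. m (i p)) {1..q} (m ` {1..k})"
    and "\<forall>p\<in>{1..q}. a p = card {j\<in>{1..k}. m j = m (i p)}"
  shows
    "let P = (\<lambda>x::real. 1 + (\<Sum>p=1..q. real (a p) * real (m (i p)) / (x + real (m (i p)))));
         poles = {- real (m (i p)) | p. p \<in> {1..q}};
         zeros = {x. x \<notin> poles \<and> P x = 0};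
         A = adj_matrix G;
         L1 = {- real (m (i p)) | p. p \<in> {1..q} \<and> a p = 1} \<inter> eigenvalues (A - ones_matrix);
         L2 = zeros \<inter> eigenvalues A;
         L3 = eigenvalues0 A - (poles \<union> zeros);
         L4 = {x. x \<notin> poles \<union> zeros \<union> eigenvalues A \<and>
                  P x * (all_ones \<bullet> (matrix_inv (A - x *\<^sub>R mat 1) *v all_ones)) = P x - 1};
         S = (\<Union>L\<in>{L1, L2, L3, L4}. L \<inter> {..<-1}) \<union>
             {- real (m (i p)) | p. p \<in> {1..q} \<and> a p \<ge> 2 \<and> m (i p) \<noteq> 1}
     in (\<exists>s\<in>S. \<forall>t\<in>S. s \<le> t) \<and> QEC (graph_join K G) = - 2 - (LEAST s. s \<in> S)"
proof -
  define P where "P = (\<lambda>x::real. 1 + (\<Sum>p=1..q. real (a p) * real (m (i p)) / (x + real (m (i p)))))"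
  define poles where "poles = {- real (m (i p)) | p. p \<in> {1..q}}"
  define zeros where "zeros = {x. x \<notin> poles \<and> P x = 0}"
  define A where "A = adj_matrix G"
  define L1 where "L1 = {- real (m (i p)) | p. p \<in> {1..q} \<and> a p = 1} \<inter> eigenvalues (A - ones_matrix)"
  define L2 where "L2 = zeros \<inter> eigenvalues A"
  define L3 where "L3 = eigenvalues0 A - (poles \<union> zeros)"
  define L4 where "L4 = {x. x \<notin> poles \<union> zeros \<union> eigenvalues A \<and>
    P x * (all_ones \<bullet> (matrix_inv (A - x *\<^sub>R mat 1) *v all_ones)) = P x - 1}"
  define M where "M = {- real (m (i p)) | p. p \<in> {1..q} \<and> a p \<ge> 2 \<and> m (i p) \<noteq> 1}"
  define S where "S = (\<Union>L\<in>{L1, L2, L3, L4}. L \<inter> {..<-1}) \<union> M"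
  define H where "H = graph_join K G"
  define C where "C = compressed_eigenvalues (adj_matrix H)"
  note K = assms(3,4) and G = assms(1,2)

  have H: "pair_graph H"
    unfolding H_def by (intro graph_join_pair_graph complete_multipartite_pair_graph[OF K(1)] G(1))
  have verts: "pverts H = UNIV"
    using K(2) G(2) by (auto simp: H_def graph_join_def UNIV_sum)
  have two: "\<exists>w. (u, w) \<in> parcs H \<and> (w, v) \<in> parcs H" if "(u, v) \<notin> parcs H" for u v
    using graph_join_common_neighbour[OF K(2) G(2)] that unfolding H_def by blast
  have dist: "dist_matrix H = 2 *\<^sub>R ones_matrix - 2 *\<^sub>R mat 1 - adj_matrix H"
    by (rule dist_matrix_diameter_two[OF H verts two])

  have m_pos: "m j \<ge> 1" if "j \<in> {1..k}" for j
    using K(1) that by (auto simp: complete_multipartite_def)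
  have img: "(\<lambda>p. m (i p)) ` {1..q} = m ` {1..k}" using assms(7) by (rule bij_betw_imp_surj_on)
  have poles_iff: "x \<in> poles \<longleftrightarrow> (\<exists>j\<in>{1..k}. x + real (m j) = 0)" for x
  proof -
    have "x \<in> poles \<longleftrightarrow> (\<exists>n\<in>(\<lambda>p. m (i p)) ` {1..q}. x = - real n)" by (auto simp: poles_def)
    also have "\<dots> \<longleftrightarrow> (\<exists>j\<in>{1..k}. x = - real (m j))" unfolding img by blast
    finally show ?thesis by (simp add: eq_neg_iff_add_eq_0)
  qed
  have P: "P x = 1 + (\<Sum>j=1..k. real (m j) / (x + real (m j)))" for x
    using sum_grouped_by_value[OF assms(7,8), of "\<lambda>n. real n / (x + real n)"] by (simp add: P_def)
  have size_inj: "p = p'" if "p \<in> {1..q}" "p' \<in> {1..q}" "m (i p) = m (i p')" for p p'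
    using inj_onD[OF bij_betw_imp_inj_on[OF assms(7)] that(3,1,2)] .

  have C_iff: "r \<in> C \<longleftrightarrow> r \<in> S" if r: "r < - 1" for r
  proof -
    have C: "r \<in> C \<longleftrightarrow> (\<exists>\<xi> y c. join_solution A k m r \<xi> y c)"
      unfolding C_def H_def A_def
      using r by (intro compressed_eigenvalue_join_iff K G(2)) simp
    show ?thesis
    proof (cases "r \<in> poles")
      case True
      then obtain p where p: "p \<in> {1..q}" "r = - real (m (i p))" by (auto simp: poles_def)
      define j where "j = i p"
      have j: "j \<in> {1..k}" using assms(6) p(1) unfolding j_def by blast
      have rj: "r = - real (m j)" using p(2) by (simp add: j_def)
      have a: "a p = card {l\<in>{1..k}. m l = m j}" using assms(8) p(1) by (simp add: j_def)
      have "j \<in> {l\<in>{1..k}. m l = m j}" using j by simp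
      then have "a p \<noteq> 0" unfolding a by (auto simp: card_eq_0_iff)
      then consider "a p = 1" | "a p \<ge> 2" by linarith
      then show ?thesis
      proof cases
        case 1
        have "r \<notin> M"
          using size_inj[OF p(1)] p(2) 1 by (fastforce simp: M_def)
        moreover have "r \<notin> L2" "r \<notin> L3" "r \<notin> L4"
          using True by (auto simp: L2_def L3_def L4_def zeros_def)
        moreover have "r \<in> L1 \<longleftrightarrow> r \<in> eigenvalues (A - ones_matrix)"
          using p 1 by (auto simp: L1_def)
        ultimately have S: "r \<in> S \<longleftrightarrow> r \<in> eigenvalues (A - ones_matrix)"
          using r by (auto simp: S_def)
        have only: "l = j" if "l \<in> {1..k}" "m l = m j" for l
        proof -
          obtain b where "{l\<in>{1..k}. m l = m j} = {b}" using 1 a card_1_singletonE by metis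
          moreover have "l \<in> {l\<in>{1..k}. m l = m j}" "j \<in> {l\<in>{1..k}. m l = m j}"
            using that j by auto
          ultimately show ?thesis by (metis singletonD)
        qed
        have "(\<exists>\<xi> y c. join_solution A k m r \<xi> y c) \<longleftrightarrow> r \<in> eigenvalues (A - ones_matrix)"
          unfolding rj by (rule join_solution_simple_part_iff[where m = m, OF j m_pos[OF j] only])
        then show ?thesis using C S by simp
      next
        case 2
        have "r \<in> M" using p 2 r by (auto simp: M_def)
        moreover have "\<exists>l\<in>{1..k}. l \<noteq> j \<and> m l = m j"
        proof (rule ccontr)
          assume "\<not> ?thesis"
          then have "{l\<in>{1..k}. m l = m j} \<subseteq> {j}" by blast
          then have "card {l\<in>{1..k}. m l = m j} \<le> 1" using card_mono[of "{j}"] by fastforce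
          then show False using a 2 by simp
        qed
        then have "\<exists>\<xi> y c. join_solution A k m r \<xi> y c"
          unfolding rj using join_solution_repeated_part[OF j] by metis
        ultimately show ?thesis unfolding C by (simp add: S_def)
      qed
    next
      case False
      then have nonpole: "r + real (m j) \<noteq> 0" if "j \<in> {1..k}" for j
        using that poles_iff by blast
      have "r \<notin> L1" "r \<notin> M" using False by (auto simp: L1_def M_def poles_def)
      then have S: "r \<in> S \<longleftrightarrow> r \<in> L2 \<or> r \<in> L3 \<or> r \<in> L4" using r by (auto simp: S_def)
      show ?thesis
      proof (cases "P r = 0")
        case True
        then have "r \<in> S \<longleftrightarrow> r \<in> eigenvalues A"
          unfolding S using False by (auto simp: L2_def L3_def L4_def zeros_def)
        then show ?thesis
          unfolding C using join_solution_zero_iff[OF nonpole] True P by simp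
      next
        case nz: False
        have "r \<in> S \<longleftrightarrow> r \<in> eigenvalues0 A \<or> r \<notin> eigenvalues A \<and>
            P r * (all_ones \<bullet> (matrix_inv (A - r *\<^sub>R mat 1) *v all_ones)) = P r - 1"
          unfolding S using False nz by (auto simp: L2_def L3_def L4_def zeros_def)
        then show ?thesis
          unfolding C using join_solution_nonzero_iff[OF _ nonpole P nz, of A]
            adj_matrix_symmetric[OF G(1)] by (simp add: A_def)
      qed
    qed
  qed

  have S_less: "s < - 1" if "s \<in> S" for s
  proof -
    have "m (i p) \<ge> 1" if "p \<in> {1..q}" for p using m_pos assms(6) that by blast
    then have "s < - 1" if "s \<in> M" for s using that by (force simp: M_def)
    then show ?thesis using that by (auto simp: S_def)
  qed

  obtain u v where uv: "u \<noteq> v" "(u, v) \<notin> parcs H"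
  proof -
    have "\<not> (parcs H = {(u, v). u \<noteq> v})"
      using assms(5) verts unfolding H_def[symmetric] complete_digraph_pair_def by simp
    moreover have "u \<noteq> v" if "(u, v) \<in> parcs H" for u v
      using pair_loopfree_digraph.pair_no_loops[OF _ that] H
      by (auto simp: pair_graph_def pair_digraph_def)
    ultimately show thesis using that by auto
  qed
  then obtain w where "(u, w) \<in> parcs H" "(w, v) \<in> parcs H" using two by blast
  then obtain f where f: "f \<noteq> 0" "all_ones \<bullet> f = 0"
    "f \<bullet> (adj_matrix H *v f) = - (4 / 3) * (f \<bullet> f)"
    using induced_path_test_vector[OF H uv] by metis
  obtain \<mu> where \<mu>: "\<mu> \<in> C"
    and ge: "\<And>f. all_ones \<bullet> f = 0 \<Longrightarrow> \<mu> * (f \<bullet> f) \<le> f \<bullet> (adj_matrix H *v f)"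
    using least_compressed_eigenvalue[OF adj_matrix_symmetric[OF H] f(1,2)] unfolding C_def by metis
  have "\<mu> * (f \<bullet> f) \<le> - (4 / 3) * (f \<bullet> f)" using ge[OF f(2)] f(3) by simp
  then have "\<mu> \<le> - (4 / 3)" using f(1) by (simp only: mult_le_cancel_right) auto
  then have "\<mu> \<in> S" using C_iff[of \<mu>] \<mu> by simp
  moreover have least: "\<mu> \<le> t" if "t \<in> S" for t
    using compressed_eigenvalue_ge[OF _ ge, of t] C_iff[OF S_less[OF that]] that
    unfolding C_def by simp
  ultimately have "(LEAST s. s \<in> S) = \<mu>" by (intro Least_equality)
  moreover have "QEC H = - 2 - \<mu>"
    using QEC_diameter_two[OF dist _ ge] \<mu> unfolding C_def by simp
  ultimately have "(\<exists>s\<in>S. \<forall>t\<in>S. s \<le> t) \<and> QEC H = - 2 - (LEAST s. s \<in> S)"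
    using \<open>\<mu> \<in> S\<close> least by auto
  then show ?thesis
    unfolding Let_def S_def M_def L1_def L2_def L3_def L4_def zeros_def poles_def A_def P_def H_def .
qed

end
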